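(* Let $R$ be a fusion ring. If $x_1,x_2\in R$ are $\mathbb{Z}_{\geq 0}$-linear combinations of basis elements of $R$, then $\mathrm{FPdim}(x_1)\in\mathbb{Q}(\mathrm{FPdim}(x_1+x_2))$ and $\mathrm{FPdim}(x_2)\in\mathbb{Q}(\mathrm{FPdim}(x_1+x_2))$.
   Context: A fusion ring is a unital ring $R$, free as a $\mathbb{Z}$-module, with a distinguished finite basis $1=b_0,\ldots,b_n$ such that (a) $b_ib_j=\sum_{k=0}^n c_{ij}^k b_k$ with $c_{ij}^k\in\mathbb{Z}_{\geq0}$, and (b) there is an anti-involution $b_i\mapsto b_i^\ast$ of the basis (extended linearly to $R$) such that $c_{ij}^0=1$ if $b_i=b_j^\ast$ and $c_{ij}^0=0$ otherwise. For a basis element $b_i$, $\mathrm{FPdim}(b_i)$ is the Frobenius-Perron eigenvalue of the nonnegative matrix $(c_{ij}^k)_{0\leq j,k\leq n}$ (its largest nonnegative real eigenvalue, equal to its spectral radius); $\mathrm{FPdim}$ is extended $\mathbb{Z}$-linearly to $R$ and is a ring homomorphism $R\to\mathbb{C}$. *)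

theory Defs
  imports
    "HOL-Algebra.Algebraic_Closure_Type"
    "HOL-Algebra.Generated_Fields"
    "Jordan_Normal_Form.Char_Poly"
begin

interpretation zmod: Modules.module "\<lambda>(k::int) (x::'a::ring_1). of_int k * x"
  by unfold_locales (simp_all add: algebra_simps)

text \<open>
  The ring is the whole type. The distinguished basis is listed without repetition as
  b 0, ..., b n; values b i with i > n are irrelevant. The map star is the
  \<open>\<int>\<close>-linear extension to the ring of the anti-involution of the basis.
\<close>

locale fusion_ring =
  fixes n :: nat and b :: "nat \<Rightarrow> 'a::ring_1" and star :: "'a \<Rightarrow> 'a"
  assumes b_0: "b 0 = 1"
    and b_inj: "inj_on b {..n}"
    and b_independent: "zmod.independent (b ` {..n})"
    and b_span: "zmod.span (b ` {..n}) = UNIV"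
    and structure_const_nonneg:
      "\<And>i j k. \<lbrakk>i \<le> n; j \<le> n; k \<le> n\<rbrakk> \<Longrightarrow>
         zmod.representation (b ` {..n}) (b i * b j) (b k) \<ge> 0"
    and star_basis: "\<And>i. i \<le> n \<Longrightarrow> star (b i) \<in> b ` {..n}"
    and star_add: "\<And>x y. star (x + y) = star x + star y"
    and star_star: "\<And>x. star (star x) = x"
    and star_mult: "\<And>x y. star (x * y) = star y * star x"
    and structure_const_0:
      "\<And>i j. \<lbrakk>i \<le> n; j \<le> n\<rbrakk> \<Longrightarrow>
         zmod.representation (b ` {..n}) (b i * b j) (b 0) = (if b i = star (b j) then 1 else 0)"
begin

definition coord :: "'a \<Rightarrow> nat \<Rightarrow> int" where
  "coord x k = zmod.representation (b ` {..n}) x (b k)"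

definition structure_const :: "nat \<Rightarrow> nat \<Rightarrow> nat \<Rightarrow> int" where
  "structure_const i j k = coord (b i * b j) k"

definition fusion_mat :: "nat \<Rightarrow> real mat" where
  "fusion_mat i = mat (Suc n) (Suc n) (\<lambda>(j, k). of_int (structure_const i j k))"

text \<open>
  The set below is finite, and it is nonempty by the Perron--Frobenius theorem,
  so the maximum is attained.
\<close>

definition FPdim_basis :: "nat \<Rightarrow> real" where
  "FPdim_basis i = Max {r. r \<ge> 0 \<and> eigenvalue (fusion_mat i) r}"

definition FPdim :: "'a \<Rightarrow> complex" where
  "FPdim x = (\<Sum>i\<le>n. of_int (coord x i) * of_real (FPdim_basis i))"

definition nonneg_combination :: "'a \<Rightarrow> bool" where
  "nonneg_combination x \<longleftrightarrow> (\<exists>a :: nat \<Rightarrow> nat. x = (\<Sum>i\<le>n. of_nat (a i) * b i))"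

end

definition rat_adjoin :: "complex \<Rightarrow> complex set" where
  "rat_adjoin z = generate_field ring_of_type_algebra (\<rat> \<union> {z})"

end

theory Submission
  imports Defs "HOL-Analysis.Function_Topology"
begin

text \<open>
  The argument replaces Galois conjugation by linear algebra over \<open>K = \<rat>(FPdim x)\<close>. The function
  \<open>FPdim\<close> is the restriction of a positive real character \<open>d\<close>, and \<open>d(x\<^sup>*) = d(x)\<close>.
  For a nonnegative \<open>x\<close>, the self-dual element \<open>y = 1 + x + x\<^sup>*\<close> acts irreducibly on the span of the
  basis elements occurring in its powers, so the values of \<open>d\<close> there are the unique normalised
  solution of a linear system over \<open>K\<close>, and hence lie in \<open>K\<close>. So \<open>K\<close> contains
  \<open>FPdim b\<close> for every basis element \<open>b\<close> occurring in \<open>x\<close>. The basis elements occurring in a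
  nonnegative summand of \<open>x\<close> are among these.
\<close>

section \<open>Perron vectors of positive matrices\<close>

text \<open>Tychonoff's theorem for boxes in a function type, whose topology is the product
  topology.\<close>

lemma compact_PiE_interval:
  fixes u v :: "'i \<Rightarrow> real"
  shows "compact (\<Pi>\<^sub>E i\<in>UNIV. {u i..v i})"
proof -
  have "compactin (product_topology (\<lambda>_. euclidean) UNIV) (\<Pi>\<^sub>E i\<in>UNIV. {u i..v i})"
    by (simp add: compactin_PiE)
  then show ?thesis
    by (simp add: euclidean_product_topology)
qed

text \<open>The type \<open>'i\<close> may be infinite, so coordinates outside \<open>I\<close> are
  pinned to 0. The simplex is then a closed subset of a box indexed by the whole type.\<close>

lemma compact_simplex:
  fixes I :: "'i set"
  assumes "finite I"
  shows "compact {f :: 'i \<Rightarrow> real. (\<forall>i\<in>I. 0 \<le> f i) \<and> (\<forall>i. i \<notin> I \<longrightarrow> f i = 0) \<and> sum f I = 1}"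
    (is "compact ?X")
proof -
  have "closed {f :: 'i \<Rightarrow> real. sum f I = 1}"
    by (intro closed_Collect_eq continuous_intros)
      (auto intro: continuous_on_product_coordinates)
  moreover have "?X = (\<Pi>\<^sub>E i\<in>UNIV. {0..if i \<in> I then 1 else 0}) \<inter> {f. sum f I = 1}"
  proof (intro equalityI subsetI)
    fix f assume f: "f \<in> ?X"
    have "f i \<le> 1" if "i \<in> I" for i
      using member_le_sum[of i I f] f that assms by auto
    with f show "f \<in> (\<Pi>\<^sub>E i\<in>UNIV. {0..if i \<in> I then 1 else 0}) \<inter> {f. sum f I = 1}"
      by (auto simp: PiE_def)
  next
    fix f :: "'i \<Rightarrow> real"
    assume f: "f \<in> (\<Pi>\<^sub>E i\<in>UNIV. {0..if i \<in> I then 1 else 0}) \<inter> {f. sum f I = 1}"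
    then have "0 \<le> f i \<and> f i \<le> (if i \<in> I then 1 else 0)" for i
      by (auto simp: PiE_def Pi_def)
    then have "(\<forall>i\<in>I. 0 \<le> f i) \<and> (\<forall>i. i \<notin> I \<longrightarrow> f i = 0)"
      by (metis order.antisym)
    with f show "f \<in> ?X"
      by simp
  qed
  ultimately show ?thesis
    by (simp only: compact_Int_closed[OF compact_PiE_interval])
qed

text \<open>Collatz--Wielandt: take the largest \<open>r\<close> with \<open>A f \<ge> r f\<close> for some \<open>f\<close> in the simplex.
  If \<open>A f \<noteq> r f\<close>, then \<open>g = A f\<close> satisfies \<open>A g > r g\<close> strictly everywhere, so \<open>r\<close> could be
  increased.\<close>

lemma positive_matrix_eigenvector:
  fixes A :: "'i \<Rightarrow> 'i \<Rightarrow> real"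
  assumes I: "finite I" "I \<noteq> {}" and A: "\<And>i j. \<lbrakk>i \<in> I; j \<in> I\<rbrakk> \<Longrightarrow> A i j > 0"
  obtains r f where "\<And>i. i \<in> I \<Longrightarrow> f i > 0" "\<And>i. i \<in> I \<Longrightarrow> (\<Sum>j\<in>I. A i j * f j) = r * f i"
proof -
  define T where "T f i = (\<Sum>j\<in>I. A i j * f j)" for f i
  define \<Delta> where "\<Delta> = {f :: 'i \<Rightarrow> real. (\<forall>i\<in>I. 0 \<le> f i) \<and> (\<forall>i. i \<notin> I \<longrightarrow> f i = 0) \<and> sum f I = 1}"
  \<comment> \<open>On the simplex every \<open>f j\<close> is at most 1, so summing
    \<open>r * f i \<le> T f i\<close> over \<open>I\<close> gives \<open>r \<le> C\<close>. Cutting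
    off at \<open>C\<close> therefore loses no pair and makes \<open>P\<close> compact.\<close>
  define C where "C = (\<Sum>i\<in>I. \<Sum>j\<in>I. A i j)"
  define P where "P = ({0..C} \<times> \<Delta>) \<inter> {p. \<forall>i\<in>I. fst p * snd p i \<le> T (snd p) i}"
  have T_pos: "T f i > 0" if "\<And>j. j \<in> I \<Longrightarrow> f j \<ge> 0" "k \<in> I" "f k > 0" "i \<in> I" for f i k
    unfolding T_def using that A I by (intro sum_pos2[of I k]) (auto intro!: mult_nonneg_nonneg simp: less_imp_le)
  have "{p :: real \<times> ('i \<Rightarrow> real). \<forall>i\<in>I. fst p * snd p i \<le> T (snd p) i} =
      (\<Inter>i\<in>I. {p. fst p * snd p i \<le> T (snd p) i})"
    by auto
  moreover have cont: "continuous_on UNIV (\<lambda>p :: real \<times> ('i \<Rightarrow> real). snd p i)" for i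
    by (rule continuous_on_compose2[OF continuous_on_product_coordinates[of i]])
      (auto intro: continuous_intros)
  have "closed {p :: real \<times> ('i \<Rightarrow> real). fst p * snd p i \<le> T (snd p) i}" for i
    unfolding T_def by (intro closed_Collect_le continuous_intros cont)
  ultimately have "closed {p :: real \<times> ('i \<Rightarrow> real). \<forall>i\<in>I. fst p * snd p i \<le> T (snd p) i}"
    by auto
  then have "compact P"
    unfolding P_def \<Delta>_def
    by (intro compact_Int_closed compact_Times compact_simplex I) auto
  moreover have "P \<noteq> {}"
  proof -
    obtain k where k: "k \<in> I" using I by auto
    let ?f = "\<lambda>i. if i = k then 1 else (0::real)"
    have "(0, ?f) \<in> P"
      using I k by (auto simp: P_def \<Delta>_def T_def C_def intro!: sum_nonneg less_imp_le[OF A])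
    then show ?thesis by auto
  qed
  ultimately obtain p where p: "p \<in> P" "\<And>q. q \<in> P \<Longrightarrow> fst q \<le> fst p"
    using continuous_attains_sup[of P fst] continuous_on_fst[OF continuous_on_id, of P] by auto
  obtain r f where rf: "p = (r, f)" by (cases p)
  have r: "0 \<le> r" and f: "\<And>i. i \<in> I \<Longrightarrow> 0 \<le> f i" "sum f I = 1"
    and Tf: "\<And>i. i \<in> I \<Longrightarrow> r * f i \<le> T f i"
    using p(1) by (auto simp: rf P_def \<Delta>_def)
  obtain k where k: "k \<in> I" "f k > 0"
    using f sum_nonpos[of I f] by (metis not_le zero_neq_one not_one_le_zero)
  have g: "T f i > 0" if "i \<in> I" for i
    using T_pos[of f k i] f(1) k that by blast
  have eig: "T f i = r * f i" if i: "i \<in> I" for i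
  proof (rule ccontr)
    assume ne: "T f i \<noteq> r * f i"
    define h where "h i = T f i - r * f i" for i
    have h: "T h j > 0" if "j \<in> I" for j
      using that Tf ne i by (intro T_pos[of h i]) (auto simp: h_def less_le)
    have Th: "T h j = T (T f) j - r * T f j" for j
      by (simp add: T_def h_def algebra_simps sum_subtractf sum_distrib_left)
    \<comment> \<open>The largest \<open>\<epsilon>\<close> with
      \<open>\<epsilon> * T f j \<le> T h j\<close> for all \<open>j\<close> in \<open>I\<close>, by
      which \<open>r\<close> can be raised when \<open>f\<close> is replaced by
      \<open>T f\<close>.\<close>
    define \<epsilon> where "\<epsilon> = Min ((\<lambda>j. T h j / T f j) ` I)"
    have \<epsilon>: "\<epsilon> > 0"
      using I g h by (auto simp: \<epsilon>_def Min_gr_iff)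
    have \<epsilon>_le: "\<epsilon> * T f j \<le> T h j" if "j \<in> I" for j
    proof -
      have "\<epsilon> \<le> T h j / T f j"
        unfolding \<epsilon>_def using I that by (intro Min_le) auto
      then show ?thesis using g[OF that] by (simp add: field_simps)
    qed
    define s where "s = sum (T f) I"
    have s: "s > 0" unfolding s_def using I g by (intro sum_pos) auto
    \<comment> \<open>\<open>T f\<close> rescaled into the simplex. The pair
      \<open>(r + \<epsilon>, q)\<close> will contradict the maximality of \<open>r\<close>.\<close>
    define q where "q j = (if j \<in> I then T f j / s else 0)" for j
    have q: "q \<in> \<Delta>"
      using g s by (auto simp: \<Delta>_def q_def s_def less_imp_le simp flip: sum_divide_distrib)
    have Tq: "T q j = T (T f) j / s" for j
      by (simp add: T_def[of q] T_def[of "T f"] q_def sum_divide_distrib)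
    have le: "(r + \<epsilon>) * q j \<le> T q j" if "j \<in> I" for j
    proof -
      have "(r + \<epsilon>) * T f j \<le> T (T f) j"
        using \<epsilon>_le[OF that] Th[of j] by (simp add: algebra_simps)
      then show ?thesis
        using s that by (simp add: Tq) (simp add: q_def divide_right_mono)
    qed
    have "q j \<le> 1" if "j \<in> I" for j
      using q member_le_sum[of j I q] that I by (auto simp: \<Delta>_def)
    then have "T q j \<le> (\<Sum>i\<in>I. A j i)" if "j \<in> I" for j
      unfolding T_def using mult_left_le[OF _ less_imp_le[OF A[OF that]]]
      by (intro sum_mono) blast
    then have "(r + \<epsilon>) * q j \<le> (\<Sum>i\<in>I. A j i)" if "j \<in> I" for j
      using le that by (meson order_trans)
    then have "(\<Sum>j\<in>I. (r + \<epsilon>) * q j) \<le> C"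
      unfolding C_def by (intro sum_mono) auto
    then have "r + \<epsilon> \<le> C"
      using q by (simp add: \<Delta>_def flip: sum_distrib_left)
    then have "(r + \<epsilon>, q) \<in> P"
      using q r \<epsilon> le by (auto simp: P_def)
    from p(2)[OF this] \<epsilon> show False by (simp add: rf)
  qed
  \<comment> \<open>A zero of \<open>f\<close> would, by the eigenvector equation, be a zero of
    \<open>T f\<close>, which is positive.\<close>
  have "f i > 0" if "i \<in> I" for i
    using g[OF that] eig[OF that] f(1)[OF that] by (cases "f i = 0") auto
  with that eig show thesis
    unfolding T_def by blast
qed

section \<open>Descent of linear systems to a subfield\<close>

text \<open>A \<open>K\<close>-independent family is grown from \<open>{1}\<close>: by induction on
  \<open>I\<close>, the value \<open>d x\<close> joins \<open>B\<close> exactly when it is not yet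
  in the \<open>K\<close>-span of \<open>B\<close>.\<close>

lemma subset_span_subfield:
  fixes K :: "'f::field set" and d :: "'i \<Rightarrow> 'f"
  assumes K: "1 \<in> K" "\<And>x y. x \<in> K \<Longrightarrow> y \<in> K \<Longrightarrow> x - y \<in> K" "\<And>x y. x \<in> K \<Longrightarrow> y \<in> K \<Longrightarrow> x * y \<in> K"
    "\<And>x. x \<in> K \<Longrightarrow> inverse x \<in> K"
    and I: "finite I"
  shows "\<exists>B a. finite B \<and> 1 \<in> B \<and>
    (\<forall>c. (\<forall>\<beta>\<in>B. c \<beta> \<in> K) \<and> (\<Sum>\<beta>\<in>B. c \<beta> * \<beta>) = 0 \<longrightarrow> (\<forall>\<beta>\<in>B. c \<beta> = 0)) \<and>
    (\<forall>i\<in>I. (\<forall>\<beta>\<in>B. a i \<beta> \<in> K) \<and> d i = (\<Sum>\<beta>\<in>B. a i \<beta> * \<beta>))"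
  using I
proof (induction I)
  case empty
  then show ?case by (intro exI[of _ "{1}"]) auto
next
  case (insert x I)
  then obtain B a where B: "finite B" "1 \<in> B"
      "\<forall>c. (\<forall>\<beta>\<in>B. c \<beta> \<in> K) \<and> (\<Sum>\<beta>\<in>B. c \<beta> * \<beta>) = 0 \<longrightarrow> (\<forall>\<beta>\<in>B. c \<beta> = 0)"
    and a: "\<forall>i\<in>I. (\<forall>\<beta>\<in>B. a i \<beta> \<in> K) \<and> d i = (\<Sum>\<beta>\<in>B. a i \<beta> * \<beta>)"
    by (elim exE conjE) (rule that)
  have K0: "0 \<in> K" using K(2)[OF K(1) K(1)] by simp
  have Km: "- y \<in> K" if "y \<in> K" for y using K(2)[OF K0 that] by simp
  show ?case
  proof (cases "\<exists>c. (\<forall>\<beta>\<in>B. c \<beta> \<in> K) \<and> d x = (\<Sum>\<beta>\<in>B. c \<beta> * \<beta>)")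
    case True
    then obtain c where c: "\<forall>\<beta>\<in>B. c \<beta> \<in> K" "d x = (\<Sum>\<beta>\<in>B. c \<beta> * \<beta>)" by blast
    show ?thesis
      by (rule exI[of _ B], rule exI[of _ "a(x := c)"]) (use B a c in auto)
  next
    case False
    have new: False if "\<forall>\<beta>\<in>B. c \<beta> \<in> K" "(\<Sum>\<beta>\<in>B. c \<beta> * \<beta>) = d x" for c
      by (rule notE[OF False]) (intro exI[of _ c] conjI that(1) that(2)[symmetric])
    have notin: "d x \<notin> B"
    proof
      assume "d x \<in> B"
      then have sum: "(\<Sum>\<beta>\<in>B. (if \<beta> = d x then 1 else 0) * \<beta>) = d x"
        using B(1) by (simp add: if_distrib[of "\<lambda>c. c * _"] cong: if_cong)
      show False
        by (rule new[OF _ sum]) (use K(1) K0 in simp)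
    qed
    have indep: "\<forall>\<beta>\<in>insert (d x) B. c \<beta> = 0"
      if c: "\<forall>\<beta>\<in>insert (d x) B. c \<beta> \<in> K" "(\<Sum>\<beta>\<in>insert (d x) B. c \<beta> * \<beta>) = 0" for c
    proof -
      have eq: "c (d x) * d x + (\<Sum>\<beta>\<in>B. c \<beta> * \<beta>) = 0"
        using c(2) B(1) notin by simp
      have "c (d x) = 0"
      proof (rule ccontr)
        assume nz: "c (d x) \<noteq> 0"
        then have "d x = - inverse (c (d x)) * (\<Sum>\<beta>\<in>B. c \<beta> * \<beta>)"
          using eq by (simp add: field_simps eq_neg_iff_add_eq_0)
        also have "\<dots> = (\<Sum>\<beta>\<in>B. (- inverse (c (d x)) * c \<beta>) * \<beta>)"
          by (simp add: sum_distrib_left mult.assoc)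
        finally have sum: "(\<Sum>\<beta>\<in>B. (- inverse (c (d x)) * c \<beta>) * \<beta>) = d x"
          by simp
        show False
          by (rule new[OF _ sum]) (use c(1) in \<open>auto intro!: K(3,4) Km\<close>)
      qed
      moreover from this eq c(1) have "\<forall>\<beta>\<in>B. c \<beta> = 0"
        by (intro mp[OF spec[OF B(3)]]) simp
      ultimately show ?thesis by simp
    qed
    \<comment> \<open>The old coefficients are reset to 0 at \<open>d x\<close>, since nothing is
      known of \<open>a i\<close> outside \<open>B\<close>.\<close>
    define a' where "a' i \<beta> = (if i = x then (if \<beta> = d x then 1 else 0)
        else if \<beta> = d x then 0 else a i \<beta>)" for i \<beta>
    have "a' i \<beta> \<in> K" if "i \<in> insert x I" "\<beta> \<in> insert (d x) B" for i \<beta>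
      using that a K(1) K0 by (auto simp: a'_def)
    moreover have "d i = (\<Sum>\<beta>\<in>insert (d x) B. a' i \<beta> * \<beta>)" if "i \<in> insert x I" for i
    proof (cases "i = x")
      case True
      have "(\<Sum>\<beta>\<in>B. a' x \<beta> * \<beta>) = 0"
        using notin by (intro sum.neutral) (auto simp: a'_def)
      with True B(1) notin show ?thesis by (simp add: a'_def)
    next
      case False
      have "(\<Sum>\<beta>\<in>B. a' i \<beta> * \<beta>) = (\<Sum>\<beta>\<in>B. a i \<beta> * \<beta>)"
        using notin False by (intro sum.cong) (auto simp: a'_def)
      with False that B(1) notin a show ?thesis by (simp add: a'_def)
    qed
    ultimately have "\<forall>i\<in>insert x I. (\<forall>\<beta>\<in>insert (d x) B. a' i \<beta> \<in> K) \<and>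
        d i = (\<Sum>\<beta>\<in>insert (d x) B. a' i \<beta> * \<beta>)"
      by blast
    moreover have "finite (insert (d x) B)" "1 \<in> insert (d x) B"
      using B by auto
    ultimately show ?thesis
      using indep by (intro exI[of _ "insert (d x) B"] exI[of _ a'] conjI allI impI) simp_all
  qed
qed

text \<open>Expand the solution in a \<open>K\<close>-independent family containing \<open>1\<close> and take coefficients of
  \<open>1\<close>.\<close>

lemma homogeneous_system_solution_subfield:
  fixes K :: "'f::field set" and d :: "'i \<Rightarrow> 'f" and M :: "'j \<Rightarrow> 'i \<Rightarrow> 'f"
  assumes K: "1 \<in> K" "\<And>x y. x \<in> K \<Longrightarrow> y \<in> K \<Longrightarrow> x - y \<in> K" "\<And>x y. x \<in> K \<Longrightarrow> y \<in> K \<Longrightarrow> x * y \<in> K"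
    "\<And>x. x \<in> K \<Longrightarrow> inverse x \<in> K"
    and I: "finite I" "k \<in> I"
    and M: "\<And>j i. j \<in> J \<Longrightarrow> i \<in> I \<Longrightarrow> M j i \<in> K"
    and d: "\<And>j. j \<in> J \<Longrightarrow> (\<Sum>i\<in>I. M j i * d i) = 0" "d k = 1"
  obtains a where "\<And>i. i \<in> I \<Longrightarrow> a i \<in> K" "\<And>j. j \<in> J \<Longrightarrow> (\<Sum>i\<in>I. M j i * a i) = 0" "a k = 1"
proof -
  obtain B a where B: "finite B" "1 \<in> B"
      "\<forall>c. (\<forall>\<beta>\<in>B. c \<beta> \<in> K) \<and> (\<Sum>\<beta>\<in>B. c \<beta> * \<beta>) = 0 \<longrightarrow> (\<forall>\<beta>\<in>B. c \<beta> = 0)"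
    and a: "\<forall>i\<in>I. (\<forall>\<beta>\<in>B. a i \<beta> \<in> K) \<and> d i = (\<Sum>\<beta>\<in>B. a i \<beta> * \<beta>)"
  proof -
    have "\<exists>B a. finite B \<and> 1 \<in> B \<and>
      (\<forall>c. (\<forall>\<beta>\<in>B. c \<beta> \<in> K) \<and> (\<Sum>\<beta>\<in>B. c \<beta> * \<beta>) = 0 \<longrightarrow> (\<forall>\<beta>\<in>B. c \<beta> = 0)) \<and>
      (\<forall>i\<in>I. (\<forall>\<beta>\<in>B. a i \<beta> \<in> K) \<and> d i = (\<Sum>\<beta>\<in>B. a i \<beta> * \<beta>))"
      by (rule subset_span_subfield) (fact K I)+
    then show thesis
      by (elim exE conjE) (rule that)
  qed
  have K0: "0 \<in> K" using K(2)[OF K(1) K(1)] by simp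
  have Kadd: "x + y \<in> K" if "x \<in> K" "y \<in> K" for x y
    using K(2)[OF that(1) K(2)[OF K0 that(2)]] by simp
  have Ksum: "sum h S \<in> K" if "\<And>i. i \<in> S \<Longrightarrow> h i \<in> K" for h and S :: "'i set"
    using that by (induction S rule: infinite_finite_induct) (auto intro: K0 Kadd)
  \<comment> \<open>As \<open>d k = 1\<close>, this compares two expansions of 1 in
    \<open>B\<close>. Independence then gives coefficient 1 at the element 1.\<close>
  have "(\<Sum>\<beta>\<in>B. (a k \<beta> - (if \<beta> = 1 then 1 else 0)) * \<beta>) = d k - 1"
    using B(1,2) bspec[OF a I(2)]
    by (simp add: left_diff_distrib sum_subtractf if_distrib[of "\<lambda>c. c * _"] cong: if_cong)
  with spec[OF B(3), of "\<lambda>\<beta>. a k \<beta> - (if \<beta> = 1 then 1 else 0)"] bspec[OF a I(2)] K K0 d(2) B(2)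
  have "a k 1 = 1" by auto
  moreover have "(\<Sum>i\<in>I. M j i * a i 1) = 0" if j: "j \<in> J" for j
  proof -
    have "(\<Sum>\<beta>\<in>B. (\<Sum>i\<in>I. M j i * a i \<beta>) * \<beta>) = (\<Sum>i\<in>I. M j i * (\<Sum>\<beta>\<in>B. a i \<beta> * \<beta>))"
      by (simp add: sum_distrib_left sum_distrib_right mult.assoc) (rule sum.swap)
    also have "\<dots> = 0" using d(1)[OF j] a by simp
    finally have "(\<Sum>\<beta>\<in>B. (\<Sum>i\<in>I. M j i * a i \<beta>) * \<beta>) = 0" .
    moreover have "\<forall>\<beta>\<in>B. (\<Sum>i\<in>I. M j i * a i \<beta>) \<in> K"
    proof (intro ballI Ksum)
      fix \<beta> i assume "\<beta> \<in> B" "i \<in> I"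
      then show "M j i * a i \<beta> \<in> K"
        using a by (intro K(3) M j) auto
    qed
    ultimately have "\<forall>\<beta>\<in>B. (\<Sum>i\<in>I. M j i * a i \<beta>) = 0"
      by (intro mp[OF spec[OF B(3)]] conjI)
    with B(2) show ?thesis
      by blast
  qed
  ultimately show thesis
    using that[of "\<lambda>i. a i 1"] a B(2) by blast
qed

section \<open>Field operations in \<open>rat_adjoin\<close>\<close>

lemma rat_adjoin_closed:
  shows rat_adjoin_one: "1 \<in> rat_adjoin z"
    and rat_adjoin_generator: "z \<in> rat_adjoin z"
    and rat_adjoin_add: "\<lbrakk>x \<in> rat_adjoin z; y \<in> rat_adjoin z\<rbrakk> \<Longrightarrow> x + y \<in> rat_adjoin z"
    and rat_adjoin_diff: "\<lbrakk>x \<in> rat_adjoin z; y \<in> rat_adjoin z\<rbrakk> \<Longrightarrow> x - y \<in> rat_adjoin z"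
    and rat_adjoin_mult: "\<lbrakk>x \<in> rat_adjoin z; y \<in> rat_adjoin z\<rbrakk> \<Longrightarrow> x * y \<in> rat_adjoin z"
    and rat_adjoin_inverse: "x \<in> rat_adjoin z \<Longrightarrow> inverse x \<in> rat_adjoin z"
    and rat_adjoin_of_int: "of_int m \<in> rat_adjoin z"
proof -
  let ?R = "ring_of_type_algebra :: complex ring"
  interpret field ?R by (rule field_from_type_algebra)
  have rat: "q \<in> rat_adjoin z" if "q \<in> \<rat>" for q
    using that generate_field.incl[of q "\<rat> \<union> {z}" ?R] by (auto simp: rat_adjoin_def)
  show "1 \<in> rat_adjoin z" "of_int m \<in> rat_adjoin z" using rat by auto
  show "z \<in> rat_adjoin z"
    using generate_field.incl[of z "\<rat> \<union> {z}" ?R] by (auto simp: rat_adjoin_def)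
  show add: "x + y \<in> rat_adjoin z" if "x \<in> rat_adjoin z" "y \<in> rat_adjoin z" for x y
    using generate_field.eng_add[of x ?R "\<rat> \<union> {z}" y] that
    by (simp add: rat_adjoin_def ring_of_type_algebra_def)
  show mult: "x * y \<in> rat_adjoin z" if "x \<in> rat_adjoin z" "y \<in> rat_adjoin z" for x y
    using generate_field.eng_mult[of x ?R "\<rat> \<union> {z}" y] that
    by (simp add: rat_adjoin_def ring_of_type_algebra_def)
  show "x - y \<in> rat_adjoin z" if "x \<in> rat_adjoin z" "y \<in> rat_adjoin z" for x y
    using add[OF that(1) mult[OF rat[of "-1"] that(2)]] by simp
  show "inverse x \<in> rat_adjoin z" if x: "x \<in> rat_adjoin z"
  proof (cases "x = 0")
    case True
    then show ?thesis using x by simp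
  next
    case False
    \<comment> \<open>The generated field is closed under the inverse of the algebraic structure,
      which uniqueness identifies with the type class inverse. Zero is separate because
      \<open>inverse 0 = 0\<close>.\<close>
    have "inv\<^bsub>?R\<^esub> x = inverse x"
      using False by (intro comm_inv_char) (auto simp: ring_of_type_algebra_def)
    then show ?thesis
      using generate_field.m_inv[of x ?R "\<rat> \<union> {z}"] x False
      by (simp add: rat_adjoin_def ring_of_type_algebra_def)
  qed
qed

lemma rat_adjoin_sum: "(\<And>i. i \<in> S \<Longrightarrow> h i \<in> rat_adjoin z) \<Longrightarrow> sum h S \<in> rat_adjoin z"
  using rat_adjoin_of_int[of 0 z]
  by (induction S rule: infinite_finite_induct) (auto intro: rat_adjoin_add)

section \<open>Functionals on a fusion ring\<close>

context fusion_ring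
begin

lemma coord_add: "coord (x + y) k = coord x k + coord y k"
  unfolding coord_def using b_independent b_span by (subst zmod.representation_add) auto

lemma coord_0 [simp]: "coord 0 k = 0"
  unfolding coord_def by (simp add: zmod.representation_zero)

lemma coord_scale: "coord (of_int m * x) k = m * coord x k"
  unfolding coord_def using b_independent b_span by (subst zmod.representation_scale) auto

lemma coord_sum: "coord (sum g S) k = (\<Sum>i\<in>S. coord (g i) k)"
  by (induction S rule: infinite_finite_induct) (simp_all add: coord_add)

lemma coord_b: "i \<le> n \<Longrightarrow> k \<le> n \<Longrightarrow> coord (b i) k = (if k = i then 1 else 0)"
  unfolding coord_def using b_independent b_inj
  by (subst zmod.representation_basis) (auto simp: inj_on_def)

lemma coord_1: "k \<le> n \<Longrightarrow> coord 1 k = (if k = 0 then 1 else 0)"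
  using coord_b[of 0 k] by (simp add: b_0)

lemma sum_coord: "(\<Sum>k\<le>n. of_int (coord x k) * b k) = x"
proof -
  have "(\<Sum>v\<in>b ` {..n}. of_int (zmod.representation (b ` {..n}) x v) * v) = x"
    using b_independent b_span by (intro zmod.sum_representation_eq) auto
  then show ?thesis
    using b_inj by (simp add: sum.reindex coord_def)
qed

lemma of_int_mult_left_commute: "x * (of_int m * y) = of_int m * (x * y)" for x y :: 'a
  by (metis mult.assoc mult_of_int_commute)

lemma coord_mult_left: "coord (x * y) k = (\<Sum>j\<le>n. coord y j * coord (x * b j) k)"
proof -
  have "x * y = (\<Sum>j\<le>n. of_int (coord y j) * (x * b j))"
    by (subst sum_coord[of y, symmetric])
      (simp add: sum_distrib_left of_int_mult_left_commute)
  then show ?thesis by (simp add: coord_sum coord_scale)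
qed

lemma coord_mult_b: "coord (x * b j) k = (\<Sum>i\<le>n. coord x i * structure_const i j k)"
  by (subst sum_coord[of x, symmetric])
    (simp add: sum_distrib_right mult.assoc coord_sum coord_scale structure_const_def)

lemma coord_mult: "coord (x * y) k = (\<Sum>i\<le>n. \<Sum>j\<le>n. coord x i * coord y j * structure_const i j k)"
  by (subst coord_mult_left, subst sum.swap) (simp add: coord_mult_b sum_distrib_left mult_ac)

lemma structure_const_ge_0: "\<lbrakk>i \<le> n; j \<le> n; k \<le> n\<rbrakk> \<Longrightarrow> structure_const i j k \<ge> 0"
  unfolding structure_const_def coord_def by (rule structure_const_nonneg)

section \<open>Nonnegative elements\<close>

definition nonneg :: "'a \<Rightarrow> bool" where
  "nonneg x \<longleftrightarrow> (\<forall>k\<le>n. coord x k \<ge> 0)"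

lemma nonneg_b: "i \<le> n \<Longrightarrow> nonneg (b i)"
  by (simp add: nonneg_def coord_b)

lemma nonneg_1: "nonneg 1"
  using nonneg_b[of 0] by (simp add: b_0)

lemma nonneg_add: "nonneg x \<Longrightarrow> nonneg y \<Longrightarrow> nonneg (x + y)"
  by (simp add: nonneg_def coord_add)

lemma nonneg_mult: "nonneg x \<Longrightarrow> nonneg y \<Longrightarrow> nonneg (x * y)"
  unfolding nonneg_def coord_mult
  by (auto intro!: sum_nonneg mult_nonneg_nonneg structure_const_ge_0)

lemma nonneg_power: "nonneg x \<Longrightarrow> nonneg (x ^ m)"
  by (induction m) (auto intro: nonneg_1 nonneg_mult)

text \<open>No cancellation is possible: the coordinate is a sum of nonnegative terms, one of them
  positive.\<close>

lemma coord_mult_pos: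
  assumes "nonneg x" "nonneg y" "i \<le> n" "j \<le> n" "k \<le> n"
    and "coord x i > 0" "coord y j > 0" "structure_const i j k > 0"
  shows "coord (x * y) k > 0"
  unfolding coord_mult using assms
  by (intro sum_pos2[of "{..n}" i] sum_pos2[of "{..n}" j] sum_nonneg)
    (auto simp: nonneg_def structure_const_ge_0)

section \<open>The involution\<close>

lemma star_b_cases:
  assumes "i \<le> n"
  obtains i' where "i' \<le> n" "star (b i) = b i'" "star (b i') = b i"
  using star_basis[OF assms] star_star by (metis atMost_iff imageE)

lemma star_0: "star 0 = 0"
  using star_add[of 0 0] by simp

lemma star_1: "star 1 = 1"
  using star_mult[of 1 "star 1"] by (simp add: star_star)

lemma star_sum: "star (sum g S) = (\<Sum>i\<in>S. star (g i))"
  by (induction S rule: infinite_finite_induct) (simp_all add: star_add star_0)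

lemma star_of_int: "star (of_int m) = of_int m"
proof -
  have nat: "star (of_nat k) = of_nat k" for k
    by (induction k) (simp_all add: star_0 star_1 star_add)
  have "star (- x) = - star x" for x
    using star_add[of x "- x"] by (simp add: star_0 eq_neg_iff_add_eq_0 add.commute)
  with nat show ?thesis
    by (cases m rule: int_cases) (simp_all del: of_nat_Suc)
qed

lemma star_power: "star (x ^ m) = star x ^ m"
  by (induction m) (simp_all add: star_1 star_mult power_commutes)

text \<open>\<open>star\<close> permutes the basis and is linear over the integers, so it permutes
  coordinates. Injectivity of \<open>b\<close> turns the permutation of elements into one of
  indices.\<close>

lemma coord_star_b:
  assumes "i \<le> n" "k \<le> n" "star (b i) = b i'" "i' \<le> n"
  shows "coord (star x) i' = coord x i"
proof -
  have "star x = (\<Sum>k\<le>n. of_int (coord x k) * star (b k))"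
    by (subst sum_coord[of x, symmetric])
      (simp add: star_sum star_mult star_of_int mult_of_int_commute)
  moreover have "coord (star (b k)) i' = (if k = i then 1 else 0)" if "k \<le> n" for k
  proof -
    obtain k' where k': "k' \<le> n" "star (b k) = b k'" "star (b k') = b k"
      using star_b_cases[OF \<open>k \<le> n\<close>] .
    have "i' = k' \<longleftrightarrow> k = i"
      using k' assms that b_inj star_star by (metis atMost_iff inj_onD)
    with k' assms show ?thesis by (simp add: coord_b)
  qed
  ultimately show ?thesis
    using assms(1) by (simp add: coord_sum coord_scale if_distrib[of "\<lambda>c. _ * c"] cong: if_cong)
qed

lemma nonneg_star:
  assumes "nonneg x"
  shows "nonneg (star x)"
  unfolding nonneg_def
proof (intro allI impI)
  fix k assume k: "k \<le> n"
  obtain k' where "k' \<le> n" "star (b k) = b k'" "star (b k') = b k"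
    using star_b_cases[OF k] .
  then show "coord (star x) k \<ge> 0"
    using coord_star_b[of k' k' k x] assms k by (auto simp: nonneg_def)
qed

lemma structure_const_dual:
  assumes "i \<le> n" "j \<le> n" "star (b i) = b j" "star (b j) = b i"
  shows "structure_const i j 0 = 1"
  using structure_const_0[of i j] assms by (simp add: structure_const_def coord_def)

text \<open>\<open>b l\<close> occurs in \<open>(b l * (b i)\<^sup>*) * b i\<close>, since \<open>1\<close> occurs in \<open>(b i)\<^sup>* * b i\<close>.\<close>

lemma ex_structure_const_pos:
  assumes "i \<le> n" "l \<le> n"
  shows "\<exists>k\<le>n. structure_const k i l > 0"
proof -
  obtain i' where i': "i' \<le> n" "star (b i) = b i'" "star (b i') = b i"
    using star_b_cases[OF assms(1)] .
  have "structure_const l 0 l > 0"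
    using assms by (simp add: structure_const_def b_0 coord_b)
  moreover have "structure_const i' i 0 > 0"
    using structure_const_dual[of i' i] i' assms by simp
  ultimately have "coord (b l * (b i' * b i)) l > 0"
    using assms i' by (intro coord_mult_pos[of "b l" "b i' * b i" l 0])
      (auto simp: coord_b intro: nonneg_mult nonneg_b simp flip: structure_const_def)
  then have "coord ((b l * b i') * b i) l > 0"
    by (simp add: mult.assoc)
  then have "(\<Sum>k\<le>n. coord (b l * b i') k * structure_const k i l) > 0"
    by (simp only: coord_mult_b)
  then obtain k where "k \<le> n" "coord (b l * b i') k * structure_const k i l > 0"
    using sum_nonpos[of "{..n}" "\<lambda>k. coord (b l * b i') k * structure_const k i l"]
    by (meson atMost_iff not_le)
  then show ?thesis
    using structure_const_ge_0[of k i l] assms by (auto simp: zero_less_mult_iff)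
qed

section \<open>Additive functionals and eigenfunctionals\<close>

text \<open>The additive functional with value \<open>f k\<close> at \<open>b k\<close>.
  Eigenvectors are handled as functionals with \<open>lin f (y * z) = \<mu> * lin f z\<close>, so
  that associativity replaces matrix computations.\<close>

definition lin :: "(nat \<Rightarrow> real) \<Rightarrow> 'a \<Rightarrow> real" where
  "lin f x = (\<Sum>k\<le>n. of_int (coord x k) * f k)"

lemma lin_add: "lin f (x + y) = lin f x + lin f y"
  by (simp add: lin_def coord_add algebra_simps sum.distrib)

lemma lin_0: "lin f 0 = 0"
  by (simp add: lin_def)

lemma lin_scale: "lin f (of_int m * x) = of_int m * lin f x"
  unfolding lin_def coord_scale sum_distrib_left of_int_mult mult.assoc ..

lemma lin_sum: "lin f (sum g S) = (\<Sum>i\<in>S. lin f (g i))"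
  by (induction S rule: infinite_finite_induct) (simp_all add: lin_add lin_0)

lemma lin_b: "i \<le> n \<Longrightarrow> lin f (b i) = f i"
  by (simp add: lin_def coord_b if_distrib[of "\<lambda>c. of_int c * _"] cong: if_cong)

lemma lin_1: "lin f 1 = f 0"
  using lin_b[of 0 f] by (simp add: b_0)

lemma lin_mult: "lin f (x * y) = (\<Sum>j\<le>n. of_int (coord y j) * lin f (x * b j))"
proof -
  have "x * y = (\<Sum>j\<le>n. of_int (coord y j) * (x * b j))"
    by (subst sum_coord[of y, symmetric])
      (simp add: sum_distrib_left of_int_mult_left_commute)
  then show ?thesis by (simp add: lin_sum lin_scale)
qed

lemma lin_mult_eigen:
  assumes "\<And>j. j \<le> n \<Longrightarrow> lin f (y * b j) = \<mu> * f j"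
  shows "lin f (y * z) = \<mu> * lin f z"
proof -
  have "lin f (y * z) = (\<Sum>j\<le>n. of_int (coord z j) * (\<mu> * f j))"
    using assms by (subst lin_mult, intro sum.cong) auto
  then show ?thesis
    unfolding lin_def sum_distrib_left by (simp add: mult.left_commute)
qed

text \<open>An additive map is automatically linear over the integers, hence determined by its
  values on the basis. This brings maps such as \<open>lin f (z * b i)\<close> in \<open>z\<close>
  into the form \<open>lin w\<close>.\<close>

lemma lin_additive:
  assumes "\<And>x y. g (x + y) = g x + g y"
  shows "lin (\<lambda>i. g (b i)) x = g x"
proof -
  interpret additive g by unfold_locales (rule assms)
  have scale: "g (of_int m * y) = of_int m * g y" for m y
  proof -
    have nat: "g (of_nat k * y) = of_nat k * g y" for k
      by (induction k) (simp_all add: zero add algebra_simps)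
    show ?thesis
      using nat by (cases m rule: int_cases2) (simp_all add: minus)
  qed
  have "g x = g (\<Sum>k\<le>n. of_int (coord x k) * b k)"
    by (simp add: sum_coord)
  also have "\<dots> = lin (\<lambda>i. g (b i)) x"
    by (simp add: sum scale lin_def)
  finally show ?thesis ..
qed

lemma eigenfunctional_power:
  assumes "\<And>z. lin f (y * z) = \<mu> * lin f z"
  shows "lin f (y ^ m * z) = \<mu> ^ m * lin f z"
  using assms by (induction m) (simp_all add: mult.assoc)

text \<open>Minimum principle: with \<open>t\<close> the minimum of \<open>w / f\<close> over the basis elements occurring in powers
  of \<open>y\<close>, attained at \<open>b i\<close>, the functional \<open>w - t f\<close> is nonnegative and kills \<open>b i\<close>, hence all
  \<open>y ^ m * b i\<close>. One of these contains \<open>1\<close> because \<open>y\<close> is self-dual.\<close>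

lemma eigenfunctional_unique:
  assumes y: "nonneg y" "star y = y"
    and f: "\<And>i. i \<le> n \<Longrightarrow> f i > 0" "\<And>z. lin f (y * z) = \<mu> * lin f z"
    and w: "\<And>z. lin w (y * z) = \<mu> * lin w z"
    and k: "k \<le> n" "coord (y ^ m) k > 0"
  shows "w k * f 0 = w 0 * f k"
proof -
  define S where "S = {k. k \<le> n \<and> (\<exists>m. coord (y ^ m) k > 0)}"
  have S: "finite S" "0 \<in> S" "k \<in> S"
    using k by (auto simp: S_def coord_1 intro: exI[of _ "0::nat"])
  define t where "t = Min ((\<lambda>i. w i / f i) ` S)"
  have "t \<in> (\<lambda>i. w i / f i) ` S"
    unfolding t_def using S by (intro Min_in) auto
  then obtain i where i: "i \<in> S" "t = w i / f i" by auto
  define u where "u j = w j - t * f j" for j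
  have u_lin: "lin u z = lin w z - t * lin f z" for z
    by (simp add: lin_def u_def algebra_simps sum_subtractf sum_distrib_left)
  have u_eig: "lin u (y ^ l * z) = \<mu> ^ l * lin u z" for l z
    by (rule eigenfunctional_power) (simp add: u_lin f w algebra_simps)
  have u_nonneg: "u j \<ge> 0" if "j \<in> S" for j
  proof -
    have "t \<le> w j / f j"
      unfolding t_def using that S by (intro Min_le) auto
    then show ?thesis
      using f(1)[of j] that by (simp add: u_def S_def field_simps)
  qed
  \<comment> \<open>A sum of nonnegative terms is zero only if every term is.\<close>
  have vanish: "u j = 0" if "nonneg z" "\<And>j. j \<le> n \<Longrightarrow> coord z j > 0 \<Longrightarrow> j \<in> S" "lin u z = 0"
      "j \<le> n" "coord z j > 0" for z j
  proof -
    have "of_int (coord z j) * u j \<ge> 0" if "j \<le> n" for j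
      using \<open>nonneg z\<close> \<open>\<And>j. j \<le> n \<Longrightarrow> coord z j > 0 \<Longrightarrow> j \<in> S\<close>[of j] u_nonneg[of j] that
      by (cases "coord z j = 0") (auto simp: nonneg_def less_le)
    then have "of_int (coord z j) * u j = 0"
      using \<open>lin u z = 0\<close> \<open>j \<le> n\<close>
        sum_nonneg_eq_0_iff[of "{..n}" "\<lambda>j. of_int (coord z j) * u j"] by (simp add: lin_def)
    with \<open>coord z j > 0\<close> show ?thesis by simp
  qed
  obtain l where il: "i \<le> n" "coord (y ^ l) i > 0"
    using i by (auto simp: S_def)
  obtain i' where i': "i' \<le> n" "star (b i) = b i'" "star (b i') = b i"
    using star_b_cases[OF il(1)] .
  have "coord (y ^ l) i' > 0"
    using coord_star_b[of i i i' "y ^ l"] il i' y(2) by (simp add: star_power)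
  then have 1: "coord (y ^ l * b i) 0 > 0"
    using il i' y by (intro coord_mult_pos[of _ _ i' i])
      (auto simp: coord_b structure_const_dual intro: nonneg_power nonneg_b)
  have "u 0 = 0"
  proof (rule vanish[OF _ _ _ _ 1])
    show "nonneg (y ^ l * b i)"
      using y il by (intro nonneg_mult nonneg_power nonneg_b)
    show "lin u (y ^ l * b i) = 0"
      using f(1)[OF il(1)] i(2) by (simp add: u_eig lin_b il u_def)
    \<comment> \<open>Since \<open>b i\<close> occurs in \<open>y ^ l\<close>, whatever occurs in
      \<open>y ^ l * b i\<close> also occurs in \<open>y ^ l * y ^ l\<close>, again a power of
      \<open>y\<close>.\<close>
    show "j \<in> S" if j: "j \<le> n" "coord (y ^ l * b i) j > 0" for j
    proof -
      have "(\<Sum>k\<le>n. coord (y ^ l) k * structure_const k i j) > 0"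
        using j by (simp only: coord_mult_b)
      then obtain k where k: "k \<le> n" "coord (y ^ l) k * structure_const k i j > 0"
        using sum_nonpos[of "{..n}" "\<lambda>k. coord (y ^ l) k * structure_const k i j"]
        by (meson atMost_iff not_le)
      then have "coord (y ^ l) k > 0" "structure_const k i j > 0"
        using structure_const_ge_0[of k i j] il j by (auto simp: zero_less_mult_iff)
      then have "coord (y ^ l * y ^ l) j > 0"
        using k il j y by (intro coord_mult_pos[of _ _ k i]) (auto intro: nonneg_power)
      then show ?thesis
        using j by (auto simp: S_def simp flip: power_add)
    qed
  qed simp
  \<comment> \<open>The eigenvalue equation at 1 reads
    \<open>lin u (y ^ m) = \<mu> ^ m * u 0\<close>.\<close>
  then have "lin u (y ^ m) = 0"
    using u_eig[of m 1] by (simp add: lin_1)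
  then have "u k = 0"
    using k y by (intro vanish[of "y ^ m"]) (auto simp: S_def intro: nonneg_power)
  with \<open>u 0 = 0\<close> show ?thesis
    by (simp add: u_def)
qed

lemma coord_eqI:
  assumes "\<And>k. k \<le> n \<Longrightarrow> coord x k = coord y k"
  shows "x = y"
proof -
  have "(\<Sum>k\<le>n. of_int (coord x k) * b k) = (\<Sum>k\<le>n. of_int (coord y k) * b k)"
    using assms by (intro sum.cong) auto
  then show ?thesis by (simp only: sum_coord)
qed

lemma star_self_dual:
  assumes "\<And>i j. \<lbrakk>i \<le> n; j \<le> n; star (b i) = b j\<rbrakk> \<Longrightarrow> coord x i = coord x j"
  shows "star x = x"
proof (rule coord_eqI)
  fix k assume k: "k \<le> n"
  obtain k' where "k' \<le> n" "star (b k) = b k'" "star (b k') = b k"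
    using star_b_cases[OF k] .
  then show "coord (star x) k = coord x k"
    using coord_star_b[of k' k' k x] assms[of k' k] k by simp
qed

section \<open>The Frobenius--Perron character\<close>

text \<open>Chosen because left multiplication by it has a strictly positive matrix, it is
  self-dual, and every basis element occurs already in its first power.\<close>

definition basis_sum :: 'a where
  "basis_sum = (\<Sum>i\<le>n. b i)"

lemma coord_basis_sum: "k \<le> n \<Longrightarrow> coord basis_sum k = 1"
  by (simp add: basis_sum_def coord_sum coord_b)

lemma nonneg_basis_sum: "nonneg basis_sum"
  by (simp add: nonneg_def coord_basis_sum)

lemma star_basis_sum: "star basis_sum = basis_sum"
  by (rule star_self_dual) (simp add: coord_basis_sum)

lemma coord_basis_sum_mult_pos:
  assumes "j \<le> n" "l \<le> n"
  shows "coord (basis_sum * b j) l > 0"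
proof -
  obtain k where "k \<le> n" "structure_const k j l > 0"
    using ex_structure_const_pos[OF assms] by blast
  then show ?thesis
    using assms by (intro coord_mult_pos[of _ _ k j])
      (auto simp: coord_basis_sum coord_b nonneg_basis_sum nonneg_b)
qed

text \<open>\<open>d 0 = 1\<close> makes \<open>lin d\<close> unital. Up to index \<open>n\<close>,
  such a \<open>d\<close> is forced to be \<open>FPdim_basis\<close>, see
  \<open>FPdim_basis_eq\<close>.\<close>

definition positive_character :: "(nat \<Rightarrow> real) \<Rightarrow> bool" where
  "positive_character d \<longleftrightarrow>
    (\<forall>i\<le>n. d i > 0) \<and> d 0 = 1 \<and> (\<forall>x y. lin d (x * y) = lin d x * lin d y)"

text \<open>Right multiplication by \<open>b i\<close> commutes with left multiplication by the sum of the basis, so it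
  acts by a scalar on the one-dimensional Perron--Frobenius eigenspace of the latter.\<close>

lemma ex_positive_character: "\<exists>d. positive_character d"
proof -
  obtain r f where f: "\<And>i. i \<in> {..n} \<Longrightarrow> f i > 0"
      "\<And>i. i \<in> {..n} \<Longrightarrow> (\<Sum>j\<le>n. real_of_int (coord (basis_sum * b i) j) * f j) = r * f i"
    by (rule positive_matrix_eigenvector[of "{..n}" "\<lambda>i j. real_of_int (coord (basis_sum * b i) j)"])
      (auto simp: coord_basis_sum_mult_pos)
  have f_eig: "lin f (basis_sum * z) = r * lin f z" for z
    using f(2) by (intro lin_mult_eigen) (simp add: lin_def)
  have f_mult: "lin f (b k * b i) * f 0 = f k * f i" if "k \<le> n" "i \<le> n" for k i
  proof -
    \<comment> \<open>By associativity, \<open>f\<close> composed with right multiplication by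
      \<open>b i\<close> is again an eigenfunctional for \<open>r\<close>, hence proportional to
      \<open>f\<close>.\<close>
    define w where "w j = lin f (b j * b i)" for j
    have "lin w z = lin f (z * b i)" for z
      unfolding w_def by (rule lin_additive) (simp add: lin_add distrib_right)
    then have "w k * f 0 = w 0 * f k"
      using that f(1)
      by (intro eigenfunctional_unique[OF nonneg_basis_sum star_basis_sum _ f_eig, of _ _ 1])
        (auto simp: f_eig mult.assoc coord_basis_sum)
    with that show ?thesis
      by (simp add: w_def b_0 lin_b mult.commute)
  qed
  define d where "d i = f i / f 0" for i
  have "f 0 > 0" using f(1) by simp
  have lin_d: "lin d x = lin f x / f 0" for x
    by (simp add: lin_def d_def sum_divide_distrib)
  have d_mult: "lin d (b k * b i) = d k * d i" if "k \<le> n" "i \<le> n" for k i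
    using f_mult[OF that] \<open>f 0 > 0\<close> by (simp add: lin_d d_def field_simps)
  have d_mult_b: "lin d (x * b i) = lin d x * d i" if "i \<le> n" for x i
  proof -
    have "lin d (x * b i) = lin (\<lambda>j. lin d (b j * b i)) x"
      by (rule lin_additive[symmetric]) (simp add: lin_add distrib_right)
    also have "\<dots> = lin d x * d i"
      using that by (simp add: lin_def[of _ x] d_mult sum_distrib_right mult.assoc)
    finally show ?thesis .
  qed
  have "lin d (x * y) = lin d x * lin d y" for x y
  proof -
    have "lin d (x * y) = (\<Sum>j\<le>n. of_int (coord y j) * (lin d x * d j))"
      by (subst lin_mult, intro sum.cong) (auto simp: d_mult_b)
    then show ?thesis
      unfolding lin_def[of d y] sum_distrib_left by (simp add: mult.left_commute)
  qed
  moreover have "d i > 0" if "i \<le> n" for i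
    using f(1)[of i] \<open>f 0 > 0\<close> that by (simp add: d_def)
  moreover have "d 0 = 1"
    using \<open>f 0 > 0\<close> by (simp add: d_def)
  ultimately show ?thesis
    unfolding positive_character_def by blast
qed

text \<open>Composing \<open>lin d\<close> with \<open>star\<close> gives an eigenfunctional of the
  self-dual \<open>basis_sum\<close> with the same eigenvalue and the same value at 1, so uniqueness
  applies.\<close>

lemma positive_character_star:
  assumes "positive_character d"
  shows "lin d (star x) = lin d x"
proof -
  have d: "d i > 0" if "i \<le> n" for i
    using that assms by (simp add: positive_character_def)
  have d0: "d 0 = 1" and mult: "lin d (y * z) = lin d y * lin d z" for y z
    using assms by (simp_all add: positive_character_def)
  define w where "w i = lin d (star (b i))" for i
  have w: "lin w z = lin d (star z)" for z
    unfolding w_def by (rule lin_additive) (simp add: lin_add star_add)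
  have "w k = d k" if "k \<le> n" for k
  proof -
    have "w k * d 0 = w 0 * d k"
      using that d
      by (intro eigenfunctional_unique[OF nonneg_basis_sum star_basis_sum, of d "lin d basis_sum" _ _ 1])
        (auto simp: w mult star_mult star_basis_sum coord_basis_sum)
    then show ?thesis
      by (simp add: w_def b_0 star_1 lin_1 d0)
  qed
  then have "lin w x = lin d x"
    by (simp add: lin_def)
  then show ?thesis
    by (simp add: w)
qed

section \<open>\<open>FPdim\<close> as the positive character\<close>

lemma fusion_mat_mult_vec:
  assumes "v \<in> carrier_vec (Suc n)" "j \<le> n"
  shows "vec_index (fusion_mat i *\<^sub>v v) j = lin (vec_index v) (b i * b j)"
proof -
  have "vec_index (fusion_mat i *\<^sub>v v) j =
      (\<Sum>k\<in>{0..<Suc n}. of_int (structure_const i j k) * vec_index v k)"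
    using assms by (auto simp: fusion_mat_def scalar_prod_def)
  then show ?thesis
    by (simp only: lin_def structure_const_def atLeast0LessThan lessThan_Suc_atMost)
qed

text \<open>An eigenvector \<open>w\<close> is compared with \<open>d\<close>: take the least
  \<open>C\<close> with \<open>\<bar>w j\<bar> \<le> C * d j\<close> for all \<open>j\<close> and
  apply the triangle inequality at an index where equality holds.\<close>

lemma fusion_mat_eigenvalue_le:
  assumes d: "positive_character d" and i: "i \<le> n" and r: "r \<ge> 0" "eigenvalue (fusion_mat i) r"
  shows "r \<le> d i"
proof -
  have d_pos: "d i > 0" if "i \<le> n" for i
    using that d by (simp add: positive_character_def)
  obtain v where v: "v \<in> carrier_vec (Suc n)" "v \<noteq> 0\<^sub>v (Suc n)"
      "fusion_mat i *\<^sub>v v = r \<cdot>\<^sub>v v"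
    using r(2) by (auto simp: eigenvalue_def eigenvector_def fusion_mat_def)
  define w where "w = vec_index v"
  have w: "lin w (b i * b j) = r * w j" if "j \<le> n" for j
    using that fusion_mat_mult_vec[OF v(1) that, of i] v(1,3) by (simp add: w_def)
  obtain k where k: "k \<le> n" "w k \<noteq> 0"
    using v(1,2) unfolding w_def by (metis carrier_vecD eq_vecI index_zero_vec less_Suc_eq_le)
  define C where "C = Max ((\<lambda>j. \<bar>w j\<bar> / d j) ` {..n})"
  have C_ge: "\<bar>w j\<bar> \<le> C * d j" if "j \<le> n" for j
  proof -
    have "\<bar>w j\<bar> / d j \<le> C"
      unfolding C_def using that by (intro Max_ge) auto
    then show ?thesis using d_pos[OF that] by (simp add: field_simps)
  qed
  have "C \<in> (\<lambda>j. \<bar>w j\<bar> / d j) ` {..n}"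
    unfolding C_def by (intro Max_in) auto
  then obtain j where "j \<le> n" "C = \<bar>w j\<bar> / d j" by auto
  then have j: "j \<le> n" "\<bar>w j\<bar> = C * d j"
    using d_pos[of j] by auto
  have "0 < C * d k"
    using C_ge[OF k(1)] k(2) by linarith
  then have "C > 0"
    using d_pos[OF k(1)] by (simp add: zero_less_mult_iff)
  have "r * (C * d j) = \<bar>lin w (b i * b j)\<bar>"
    using w[OF j(1)] j(2) r(1) by (simp add: abs_mult)
  also have "\<dots> \<le> (\<Sum>k\<le>n. \<bar>of_int (structure_const i j k) * w k\<bar>)"
    unfolding lin_def structure_const_def by (rule sum_abs)
  also have "\<dots> \<le> (\<Sum>k\<le>n. of_int (structure_const i j k) * (C * d k))"
    using i j C_ge by (intro sum_mono) (auto simp: abs_mult structure_const_ge_0 intro!: mult_mono)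
  also have "\<dots> = C * lin d (b i * b j)"
    by (simp add: lin_def structure_const_def sum_distrib_left mult_ac)
  also have "\<dots> = d i * (C * d j)"
    using d i j by (simp add: positive_character_def lin_b)
  finally show ?thesis
    using \<open>C > 0\<close> d_pos[OF j(1)] by simp
qed

text \<open>\<open>d\<close> is itself an eigenvector with eigenvalue \<open>d i\<close>, so the
  preceding bound is attained. \<open>Max\<close> also needs finitely many eigenvalues, which are
  roots of the characteristic polynomial.\<close>

lemma FPdim_basis_eq:
  assumes d: "positive_character d" and i: "i \<le> n"
  shows "FPdim_basis i = d i"
  unfolding FPdim_basis_def
proof (rule Max_eqI)
  have carrier: "fusion_mat i \<in> carrier_mat (Suc n) (Suc n)"
    by (simp add: fusion_mat_def)
  have "char_poly (fusion_mat i) \<noteq> 0"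
    using degree_monic_char_poly[OF carrier] by auto
  then have "finite {r. eigenvalue (fusion_mat i) r}"
    unfolding eigenvalue_root_char_poly[OF carrier] by (rule poly_roots_finite)
  then show "finite {r. r \<ge> 0 \<and> eigenvalue (fusion_mat i) r}"
    by (rule rev_finite_subset) auto
  show "r \<le> d i" if "r \<in> {r. r \<ge> 0 \<and> eigenvalue (fusion_mat i) r}" for r
    using that fusion_mat_eigenvalue_le[OF d i] by auto
  let ?v = "vec (Suc n) d"
  have "fusion_mat i *\<^sub>v ?v = d i \<cdot>\<^sub>v ?v"
  proof (rule eq_vecI)
    fix j assume "j < dim_vec (d i \<cdot>\<^sub>v ?v)"
    then have j: "j \<le> n" by simp
    have "vec_index (fusion_mat i *\<^sub>v ?v) j = lin d (b i * b j)"
      by (subst fusion_mat_mult_vec) (use j in \<open>auto simp: lin_def\<close>)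
    also have "\<dots> = d i * d j"
      using d i j by (simp add: positive_character_def lin_b)
    finally show "vec_index (fusion_mat i *\<^sub>v ?v) j = vec_index (d i \<cdot>\<^sub>v ?v) j"
      using j by simp
  qed (simp add: fusion_mat_def)
  moreover have "?v \<noteq> 0\<^sub>v (Suc n)"
  proof
    assume "?v = 0\<^sub>v (Suc n)"
    then have "vec_index ?v 0 = vec_index (0\<^sub>v (Suc n)) 0" by simp
    with d show False by (simp add: positive_character_def)
  qed
  ultimately have "eigenvalue (fusion_mat i) (d i)"
    unfolding eigenvalue_def eigenvector_def by (intro exI[of _ ?v]) (auto simp: fusion_mat_def)
  then show "d i \<in> {r. r \<ge> 0 \<and> eigenvalue (fusion_mat i) r}"
    using d i by (auto simp: positive_character_def less_imp_le)
qed

lemma FPdim_eq: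
  assumes "positive_character d"
  shows "FPdim x = of_real (lin d x)"
  using FPdim_basis_eq[OF assms] by (simp add: FPdim_def lin_def)

section \<open>Descent to the field generated by \<open>FPdim x\<close>\<close>

lemma nonneg_combination_imp_nonneg: "nonneg_combination x \<Longrightarrow> nonneg x"
  by (auto simp: nonneg_combination_def nonneg_def coord_sum coord_b
      coord_scale[of "int m" for m, simplified] intro!: sum_nonneg)

text \<open>Since \<open>d(1 + x + x\<^sup>*) = 1 + 2 d(x)\<close>, passing from \<open>x\<close> to the self-dual element
  \<open>1 + x + x\<^sup>*\<close> does not change the field.\<close>

lemma FPdim_constituent_in_rat_adjoin:
  assumes x: "nonneg x" and k: "k \<le> n" "coord x k > 0"
  shows "FPdim (b k) \<in> rat_adjoin (FPdim x)"
proof -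
  obtain d where d: "positive_character d"
    using ex_positive_character by blast
  have d_pos: "\<And>i. i \<le> n \<Longrightarrow> d i > 0" and d_0: "d 0 = 1"
    and d_mult: "\<And>x y. lin d (x * y) = lin d x * lin d y"
    using d by (auto simp: positive_character_def)
  \<comment> \<open>The real part of the field: the minimum principle behind uniqueness needs
    ordered scalars.\<close>
  define K where "K = {t :: real. complex_of_real t \<in> rat_adjoin (FPdim x)}"
  have K_of_int: "of_int m \<in> K" for m
    using rat_adjoin_of_int[of m "FPdim x"] by (simp add: K_def)
  have K_diff: "s - t \<in> K" if "s \<in> K" "t \<in> K" for s t
    using that by (simp add: K_def rat_adjoin_diff)
  define y where "y = 1 + x + star x"
  have y: "nonneg y" "star y = y"
    using x by (auto simp: y_def star_add star_1 star_star add_ac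
        intro!: nonneg_add nonneg_1 nonneg_star)
  define \<mu> where "\<mu> = lin d y"
  have "\<mu> = 1 + lin d x + lin d x"
    by (simp add: \<mu>_def y_def lin_add lin_1 d_0 positive_character_star[OF d])
  then have \<mu>: "\<mu> \<in> K"
    by (simp only: K_def mem_Collect_eq of_real_add of_real_1 FPdim_eq[OF d, symmetric]
        rat_adjoin_add rat_adjoin_one rat_adjoin_generator)
  \<comment> \<open>The system with matrix \<open>M\<close> says that \<open>lin a\<close> is an
    eigenfunctional of \<open>y\<close> for \<open>\<mu>\<close>. Its entries lie in
    \<open>K\<close>, and \<open>d\<close> solves it.\<close>
  define M where "M j i = of_int (coord (y * b j) i) - (if i = j then \<mu> else 0)" for j i
  have M: "(\<Sum>i\<le>n. M j i * a i) = lin a (y * b j) - \<mu> * a j" if "j \<le> n" for a j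
  proof -
    have "(\<Sum>i\<le>n. M j i * a i) =
        lin a (y * b j) - (\<Sum>i\<le>n. (if i = j then \<mu> else 0) * a i)"
      by (simp add: M_def lin_def left_diff_distrib sum_subtractf)
    also have "(\<Sum>i\<le>n. (if i = j then \<mu> else 0) * a i) = \<mu> * a j"
      using that by (simp add: if_distrib[of "\<lambda>c. c * _"] cong: if_cong)
    finally show ?thesis .
  qed
  obtain a where a: "\<And>i. i \<in> {..n} \<Longrightarrow> a i \<in> K"
      "\<And>j. j \<in> {..n} \<Longrightarrow> (\<Sum>i\<le>n. M j i * a i) = 0" "a 0 = 1"
  proof (rule homogeneous_system_solution_subfield[of K "{..n}" 0 "{..n}" M d])
    show "s * t \<in> K" if "s \<in> K" "t \<in> K" for s t
      using that by (simp add: K_def rat_adjoin_mult)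
    show "inverse t \<in> K" if "t \<in> K" for t
      using that by (simp add: K_def rat_adjoin_inverse)
    show "M j i \<in> K" for j i
      unfolding M_def using \<mu> K_of_int[of 0] by (intro K_diff K_of_int) auto
    show "(\<Sum>i\<le>n. M j i * d i) = 0" if "j \<in> {..n}" for j
      using that by (simp add: M d_mult lin_b \<mu>_def)
    show "1 \<in> K"
      using K_of_int[of 1] by simp
  qed (use K_diff d_0 in auto)
  have a_eig: "lin a (y * z) = \<mu> * lin a z" for z
  proof (rule lin_mult_eigen)
    show "lin a (y * b j) = \<mu> * a j" if "j \<le> n" for j
      using a(2)[of j] M[OF that, of a] that by simp
  qed
  \<comment> \<open>\<open>b k\<close> occurs in \<open>x\<close>, hence in \<open>y\<close> itself,
    so uniqueness applies at \<open>k\<close> with exponent 1.\<close>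
  have "coord (y ^ 1) k > 0"
    using k nonneg_star[OF x] by (auto simp: y_def coord_add coord_1 nonneg_def)
  then have "a k * d 0 = a 0 * d k"
    by (intro eigenfunctional_unique[where m = 1, OF y d_pos _ a_eig k(1)]) (simp_all add: d_mult \<mu>_def)
  then have "d k \<in> K"
    using a(1)[of k] a(3) d_0 k(1) by simp
  then show ?thesis
    by (simp add: K_def FPdim_eq[OF d] lin_b k)
qed

text \<open>Nonnegative coordinates cannot cancel, so each basis element occurring in
  \<open>x\<close> occurs in \<open>x + z\<close> and has its dimension in the field.
  \<open>FPdim x\<close> is an integer combination of these.\<close>

lemma FPdim_summand_in_rat_adjoin:
  assumes x: "nonneg x" "nonneg z"
  shows "FPdim x \<in> rat_adjoin (FPdim (x + z))"
proof -
  let ?K = "rat_adjoin (FPdim (x + z))"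
  have "of_int (coord x i) * of_real (FPdim_basis i) \<in> ?K" if i: "i \<le> n" for i
  proof (cases "coord x i = 0")
    case True
    then show ?thesis using rat_adjoin_of_int[of 0] by simp
  next
    case False
    then have "coord (x + z) i > 0"
      using x i by (auto simp: nonneg_def coord_add less_le add_nonneg_eq_0_iff)
    then have "FPdim (b i) \<in> ?K"
      using FPdim_constituent_in_rat_adjoin[of "x + z" i] nonneg_add[OF x] i by blast
    moreover have "FPdim (b i) = of_real (FPdim_basis i)"
      using i by (simp add: FPdim_def coord_b if_distrib[of "\<lambda>c. of_int c * _"] cong: if_cong)
    ultimately show ?thesis
      by (simp add: rat_adjoin_mult rat_adjoin_of_int)
  qed
  then show ?thesis
    unfolding FPdim_def[of x] by (intro rat_adjoin_sum) simp
qed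

end

theorem lemma2p1:
  fixes n :: nat and b :: "nat \<Rightarrow> 'a::ring_1" and star :: "'a \<Rightarrow> 'a" and x\<^sub>1 x\<^sub>2 :: 'a
  assumes "fusion_ring n b star"
    and "fusion_ring.nonneg_combination n b x\<^sub>1"
    and "fusion_ring.nonneg_combination n b x\<^sub>2"
  shows "fusion_ring.FPdim n b x\<^sub>1 \<in> rat_adjoin (fusion_ring.FPdim n b (x\<^sub>1 + x\<^sub>2))
       \<and> fusion_ring.FPdim n b x\<^sub>2 \<in> rat_adjoin (fusion_ring.FPdim n b (x\<^sub>1 + x\<^sub>2))"
proof -
  interpret fusion_ring n b star by fact
  have "nonneg x\<^sub>1" "nonneg x\<^sub>2"
    using assms(2,3) by (auto intro: nonneg_combination_imp_nonneg)
  then show ?thesis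
    using FPdim_summand_in_rat_adjoin[of x\<^sub>1 x\<^sub>2] FPdim_summand_in_rat_adjoin[of x\<^sub>2 x\<^sub>1]
    by (simp add: add.commute)
qed

end
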